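(* Let $\mathcal{G}$ be a $\mathbb{Z}$-graded ample groupoid. Then there is an exact sequence of abelian groups $$H_0^{\mathrm{gr}}(\mathcal{G})\xrightarrow{\ \widetilde{\Lambda}\ }H_0^{\mathrm{gr}}(\mathcal{G})\xrightarrow{\ \widetilde{\Sigma}\ }H_0(\mathcal{G})\longrightarrow 0,$$ where $\widetilde\Lambda$ and $\widetilde\Sigma$ are the homomorphisms induced on homology by the maps $\Lambda$ and $\Sigma$ described in the context.
   Context: Groupoids: source $s(g)=g^{-1}g$, range $r(g)=gg^{-1}$, unit space $\mathcal{G}^{(0)}$; $(g,h)$ is composable iff $s(g)=r(h)$. An étale groupoid is a locally compact Hausdorff topological groupoid whose source map is a local homeomorphism; it is ample if its topology has a basis of compact open bisections (open sets $U$ on which $s$ and $r$ restrict to homeomorphisms onto open subsets of $\mathcal{G}^{(0)}$). A $\mathbb{Z}$-graded groupoid is a topological groupoid with a continuous map $c:\mathcal{G}\to\mathbb{Z}$ satisfying $c(gh)=c(g)+c(h)$ for composable $g,h$. The zeroth homology of an étale groupoid $\mathcal{G}$ is $H_0(\mathcal{G})=C_c(\mathcal{G}^{(0)},\mathbb{Z})/\operatorname{Im}\partial_1$, where $C_c(X,\mathbb{Z})$ is the group of continuous compactly supported functions $X\to\mathbb{Z}$ ($\mathbb{Z}$ discrete) and $\partial_1:C_c(\mathcal{G},\mathbb{Z})\to C_c(\mathcal{G}^{(0)},\mathbb{Z})$ is $\partial_1(f)(x)=\sum_{s(g)=x}f(g)-\sum_{r(g)=x}f(g)$. The skew-product $\mathcal{G}\times_c\mathbb{Z}$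 is the space $\mathcal{G}\times\mathbb{Z}$ with the product topology, source $s(x,n)=(s(x),n)$, range $r(x,n)=(r(x),c(x)+n)$, product $(x,c(y)+n)(y,n)=(xy,n)$, inverse $(x,n)^{-1}=(x^{-1},c(x)+n)$; its unit space is $\mathcal{G}^{(0)}\times\mathbb{Z}$. The graded zeroth homology is $H_0^{\mathrm{gr}}(\mathcal{G})=H_0(\mathcal{G}\times_c\mathbb{Z})$. Identify $C_c(\mathcal{G}^{(0)}\times\mathbb{Z},\mathbb{Z})$ with $\bigoplus_{\mathbb{Z}}C_c(\mathcal{G}^{(0)},\mathbb{Z})$ via $f\mapsto\{f_i\}_{i\in\mathbb{Z}}$, $f_i(x)=f(x,i)$. Put $\Lambda(\{f_i\}_{i})=\{f_{i-1}\}_{i}-\{f_i\}_{i}$ and $\Sigma(\{f_i\}_i)=\sum_i f_i\in C_c(\mathcal{G}^{(0)},\mathbb{Z})$. *)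

theory Defs
  imports "HOL-Analysis.Analysis" "HOL-Algebra.Coset"
begin

section \<open>Topological groupoids\<close>

text \<open>
  A groupoid lives on the point set of its topology; \<open>gmult\<close> is meaningful on composable pairs only.
\<close>

record 'a groupoid_data =
  gtop :: "'a topology"
  gmult :: "'a \<Rightarrow> 'a \<Rightarrow> 'a"
  ginv :: "'a \<Rightarrow> 'a"

definition arrows :: "'a groupoid_data \<Rightarrow> 'a set" where
  "arrows G = topspace (gtop G)"

definition source :: "'a groupoid_data \<Rightarrow> 'a \<Rightarrow> 'a" where
  "source G g = gmult G (ginv G g) g"

definition range_map :: "'a groupoid_data \<Rightarrow> 'a \<Rightarrow> 'a" where
  "range_map G g = gmult G g (ginv G g)"

definition composable :: "'a groupoid_data \<Rightarrow> ('a \<times> 'a) set" where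
  "composable G = {(g, h). g \<in> arrows G \<and> h \<in> arrows G \<and> source G g = range_map G h}"

definition units :: "'a groupoid_data \<Rightarrow> 'a set" where
  "units G = source G ` arrows G"

definition unit_space :: "'a groupoid_data \<Rightarrow> 'a topology" where
  "unit_space G = subtopology (gtop G) (units G)"

locale algebraic_groupoid =
  fixes G :: "'a groupoid_data"
  assumes inv_closed: "g \<in> arrows G \<Longrightarrow> ginv G g \<in> arrows G"
    and inv_inv: "g \<in> arrows G \<Longrightarrow> ginv G (ginv G g) = g"
    and mult_closed: "(g, h) \<in> composable G \<Longrightarrow> gmult G g h \<in> arrows G"
    and mult_composable_left:
      "(g, h) \<in> composable G \<Longrightarrow> (h, k) \<in> composable G \<Longrightarrow> (gmult G g h, k) \<in> composable G"
    and mult_composable_right: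
      "(g, h) \<in> composable G \<Longrightarrow> (h, k) \<in> composable G \<Longrightarrow> (g, gmult G h k) \<in> composable G"
    and assoc:
      "(g, h) \<in> composable G \<Longrightarrow> (h, k) \<in> composable G \<Longrightarrow>
        gmult G (gmult G g h) k = gmult G g (gmult G h k)"
    and inv_mult_cancel: "(g, h) \<in> composable G \<Longrightarrow> gmult G (ginv G g) (gmult G g h) = h"
    and mult_inv_cancel: "(g, h) \<in> composable G \<Longrightarrow> gmult G (gmult G g h) (ginv G h) = g"

locale topological_groupoid = algebraic_groupoid +
  assumes continuous_inv: "continuous_map (gtop G) (gtop G) (ginv G)"
    and continuous_mult:
      "continuous_map (subtopology (prod_topology (gtop G) (gtop G)) (composable G)) (gtop G)
        (\<lambda>(g, h). gmult G g h)"

definition local_homeomorphism :: "'a topology \<Rightarrow> 'b topology \<Rightarrow> ('a \<Rightarrow> 'b) \<Rightarrow> bool" where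
  "local_homeomorphism X Y f \<longleftrightarrow>
    (\<forall>x \<in> topspace X. \<exists>U. openin X U \<and> x \<in> U \<and> openin Y (f ` U) \<and>
      homeomorphic_map (subtopology X U) (subtopology Y (f ` U)) f)"

locale etale_groupoid = topological_groupoid +
  assumes locally_compact: "locally_compact_space (gtop G)"
    and Hausdorff: "Hausdorff_space (gtop G)"
    and etale: "local_homeomorphism (gtop G) (unit_space G) (source G)"

definition open_bisection :: "'a groupoid_data \<Rightarrow> 'a set \<Rightarrow> bool" where
  "open_bisection G U \<longleftrightarrow> openin (gtop G) U \<and>
    (\<forall>f \<in> {source G, range_map G}. openin (unit_space G) (f ` U) \<and>
      homeomorphic_map (subtopology (gtop G) U) (subtopology (unit_space G) (f ` U)) f)"

locale ample_groupoid = etale_groupoid +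
  assumes compact_open_bisection_basis:
    "openin (gtop G) W \<Longrightarrow> g \<in> W \<Longrightarrow>
      \<exists>U. open_bisection G U \<and> compactin (gtop G) U \<and> g \<in> U \<and> U \<subseteq> W"

locale graded_groupoid = topological_groupoid G for G :: "'a groupoid_data" +
  fixes c :: "'a \<Rightarrow> int"
  assumes continuous_degree: "continuous_map (gtop G) (discrete_topology UNIV) c"
    and degree_mult: "(g, h) \<in> composable G \<Longrightarrow> c (gmult G g h) = c g + c h"

section \<open>Zeroth homology\<close>

text \<open>
  The abelian group \<open>C\<^sub>c(X, \<int>)\<close>, written multiplicatively as a \<open>monoid\<close> record.
  The condition \<open>f x = 0\<close> outside the space makes functions on a subset of the type unique;
  it says nothing about the behaviour of \<open>f\<close> on the space itself.
\<close>

definition Cc :: "'a topology \<Rightarrow> ('a \<Rightarrow> int) monoid" where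
  "Cc X = \<lparr>carrier = {f. continuous_map X (discrete_topology UNIV) f \<and>
                         compactin X (X closure_of {x \<in> topspace X. f x \<noteq> 0}) \<and>
                         (\<forall>x. x \<notin> topspace X \<longrightarrow> f x = 0)},
           mult = (\<lambda>f g x. f x + g x),
           one = (\<lambda>x. 0)\<rparr>"

text \<open>
  \<open>supp_sum\<close> sums over the points with nonzero value; over a fibre of \<open>source G\<close> or
  \<open>range_map G\<close> there are finitely many of them when \<open>G\<close> is etale and \<open>f\<close> has compact support.
\<close>

definition boundary :: "'a groupoid_data \<Rightarrow> ('a \<Rightarrow> int) \<Rightarrow> ('a \<Rightarrow> int)" where
  "boundary G f = (\<lambda>x. if x \<in> units G
     then supp_sum f {g \<in> arrows G. source G g = x} - supp_sum f {g \<in> arrows G. range_map G g = x}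
     else 0)"

definition boundaries :: "'a groupoid_data \<Rightarrow> ('a \<Rightarrow> int) set" where
  "boundaries G = boundary G ` carrier (Cc (gtop G))"

definition H0 :: "'a groupoid_data \<Rightarrow> ('a \<Rightarrow> int) set monoid" where
  "H0 G = Cc (unit_space G) Mod boundaries G"

definition homology_class :: "'a groupoid_data \<Rightarrow> ('a \<Rightarrow> int) \<Rightarrow> ('a \<Rightarrow> int) set" where
  "homology_class G f = boundaries G #>\<^bsub>Cc (unit_space G)\<^esub> f"

text \<open>
  The map on classes induced by \<open>\<phi>\<close>, with values in \<open>H0 K\<close>. It is meaningful only if
  the class of \<open>\<phi> f\<close> in \<open>H0 K\<close> does not depend on the representative \<open>f\<close> in \<open>X\<close>.
\<close>

definition induced_map ::
  "'b groupoid_data \<Rightarrow> (('a \<Rightarrow> int) \<Rightarrow> ('b \<Rightarrow> int)) \<Rightarrow> ('a \<Rightarrow> int) set \<Rightarrow> ('b \<Rightarrow> int) set" where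
  "induced_map K \<phi> X = the_elem ((\<lambda>f. homology_class K (\<phi> f)) ` X)"

section \<open>Graded zeroth homology\<close>

text \<open>
  A pair \<open>((x, m), (y, n))\<close> is composable in the skew product iff \<open>(x, y)\<close> is composable
  and \<open>m = c y + n\<close>, so \<open>m\<close> carries no further information in the product.
\<close>

definition skew_product :: "'a groupoid_data \<Rightarrow> ('a \<Rightarrow> int) \<Rightarrow> ('a \<times> int) groupoid_data" where
  "skew_product G c =
    \<lparr>gtop = prod_topology (gtop G) (discrete_topology UNIV),
     gmult = (\<lambda>(x, m) (y, n). (gmult G x y, n)),
     ginv = (\<lambda>(x, n). (ginv G x, c x + n))\<rparr>"

lemma source_skew_product [simp]: "source (skew_product G c) (x, n) = (source G x, n)"
  by (simp add: source_def skew_product_def)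

lemma range_map_skew_product [simp]:
  "range_map (skew_product G c) (x, n) = (range_map G x, c x + n)"
  by (simp add: range_map_def skew_product_def)

lemma arrows_skew_product [simp]: "arrows (skew_product G c) = arrows G \<times> UNIV"
  by (simp add: arrows_def skew_product_def)

lemma units_skew_product [simp]: "units (skew_product G c) = units G \<times> UNIV"
  by (force simp: units_def)

lemma composable_skew_product:
  "((x, m), (y, n)) \<in> composable (skew_product G c) \<longleftrightarrow> (x, y) \<in> composable G \<and> m = c y + n"
  by (auto simp: composable_def)

definition H0_gr :: "'a groupoid_data \<Rightarrow> ('a \<Rightarrow> int) \<Rightarrow> ('a \<times> int \<Rightarrow> int) set monoid" where
  "H0_gr G c = H0 (skew_product G c)"

definition component :: "('a \<times> int \<Rightarrow> int) \<Rightarrow> int \<Rightarrow> 'a \<Rightarrow> int" where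
  "component f i = (\<lambda>x. f (x, i))"

definition Lambda :: "('a \<times> int \<Rightarrow> int) \<Rightarrow> ('a \<times> int \<Rightarrow> int)" where
  "Lambda f = (\<lambda>(x, i). component f (i - 1) x - component f i x)"

definition Sigma_sum :: "('a \<times> int \<Rightarrow> int) \<Rightarrow> ('a \<Rightarrow> int)" where
  "Sigma_sum f = (\<lambda>x. supp_sum (\<lambda>i. component f i x) UNIV)"

definition Lambda_tilde ::
  "'a groupoid_data \<Rightarrow> ('a \<Rightarrow> int) \<Rightarrow> ('a \<times> int \<Rightarrow> int) set \<Rightarrow> ('a \<times> int \<Rightarrow> int) set" where
  "Lambda_tilde G c = induced_map (skew_product G c) Lambda"

definition Sigma_tilde ::
  "'a groupoid_data \<Rightarrow> ('a \<times> int \<Rightarrow> int) set \<Rightarrow> ('a \<Rightarrow> int) set" where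
  "Sigma_tilde G = induced_map G Sigma_sum"

end

theory Submission
  imports Defs
begin

text \<open>
  Everything is expressed through one construction. A local homeomorphism \<open>p\<close> between Hausdorff
  spaces pushes a compactly supported integer function \<open>f\<close> forward to the function \<open>p\<^sub>* f\<close> whose value
  at \<open>y\<close> is the sum of \<open>f\<close> over the fibre of \<open>y\<close>. The essential point is that \<open>p\<^sub>* f\<close> is again locally
  constant with compact support (\<open>pushforward_Cc\<close>); in addition \<open>p\<^sub>*\<close> is additive, and
  \<open>(q \<circ> p)\<^sub>* = q\<^sub>* p\<^sub>*\<close> (\<open>pushforward_compose\<close>).

  In these terms \<open>\<partial>\<^sub>1 = s\<^sub>* - r\<^sub>*\<close>, the map \<open>\<Sigma>\<close> is \<open>fst\<^sub>*\<close>, and \<open>\<Lambda> = \<sigma>\<^sub>* - id\<close> for the shift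
  \<open>\<sigma> (x, n) = (x, 1 + n)\<close>. Both \<open>fst\<close> and \<open>\<sigma>\<close> are defined on arrows as well as on units and commute
  with sources and ranges, so functoriality alone shows that \<open>\<Sigma>\<close> and \<open>\<Lambda>\<close> commute with the
  boundaries (\<open>pushforward_boundary\<close>) and hence descend to homology. Likewise \<open>fst \<circ> \<sigma> = fst\<close> gives
  \<open>\<Sigma> \<Lambda> = 0\<close>, and the inclusion \<open>x \<mapsto> (x, 0)\<close>, a section of \<open>fst\<close>, makes \<open>\<Sigma>\<close> surjective.

  For exactness in the middle, let \<open>\<Sigma> f = \<partial>\<^sub>1 h\<close>. Placing \<open>h\<close> on the slice of arrows \<open>(g, 0)\<close> gives
  \<open>k\<close> with \<open>\<Sigma> (\<partial>\<^sub>1 k) = \<partial>\<^sub>1 h\<close>. So \<open>f - \<partial>\<^sub>1 k\<close>, which represents the same class as \<open>f\<close>, is in the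
  kernel of \<open>\<Sigma>\<close> on functions, and that kernel is the image of \<open>\<Lambda>\<close>: summing the components above
  a given degree inverts the difference operator (\<open>Sigma_sum_zero_imp_Lambda\<close>).
\<close>

section \<open>Locally constant functions with compact support\<close>

lemma continuous_map_discrete_iff_locally_constant:
  "continuous_map X (discrete_topology UNIV) f \<longleftrightarrow>
    (\<forall>x \<in> topspace X. \<exists>U. openin X U \<and> x \<in> U \<and> (\<forall>y \<in> U. f y = f x))"
proof
  assume f: "continuous_map X (discrete_topology UNIV) f"
  show "\<forall>x \<in> topspace X. \<exists>U. openin X U \<and> x \<in> U \<and> (\<forall>y \<in> U. f y = f x)"
  proof
    fix x assume "x \<in> topspace X"
    moreover have "openin X {y \<in> topspace X. f y \<in> {f x}}"
      using f by (rule openin_continuous_map_preimage) simp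
    ultimately show "\<exists>U. openin X U \<and> x \<in> U \<and> (\<forall>y \<in> U. f y = f x)"
      by (intro exI[of _ "{y \<in> topspace X. f y \<in> {f x}}"]) auto
  qed
next
  assume loc: "\<forall>x \<in> topspace X. \<exists>U. openin X U \<and> x \<in> U \<and> (\<forall>y \<in> U. f y = f x)"
  have "openin X {x \<in> topspace X. f x \<in> V}" for V
  proof (subst openin_subopen, clarify)
    fix x assume x: "x \<in> topspace X" "f x \<in> V"
    then obtain U where "openin X U" "x \<in> U" "\<forall>y \<in> U. f y = f x"
      using loc by blast
    moreover from this have "U \<subseteq> {x \<in> topspace X. f x \<in> V}"
      using x(2) openin_subset by fastforce
    ultimately show "\<exists>T. openin X T \<and> x \<in> T \<and> T \<subseteq> {x \<in> topspace X. f x \<in> V}"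
      by blast
  qed
  then show "continuous_map X (discrete_topology UNIV) f"
    by (simp add: continuous_map_def)
qed

lemma locally_constant_nbhd:
  assumes "continuous_map X (discrete_topology UNIV) f" "x \<in> topspace X"
  shows "\<exists>U. openin X U \<and> x \<in> U \<and> (\<forall>y \<in> U. f y = f x)"
  using assms(1) assms(2) by (rule continuous_map_discrete_iff_locally_constant[THEN iffD1, THEN bspec])

lemma closedin_preimage_discrete:
  assumes "continuous_map X (discrete_topology UNIV) f"
  shows "closedin X {x \<in> topspace X. f x \<in> V}"
  using assms by (rule closedin_continuous_map_preimage) simp

text \<open>
  The support of a locally constant function is closed, hence equal to its closure; and a
  compact set lies in the space, which accounts for the vanishing of \<open>f\<close> off the space.
\<close>

lemma Cc_iff:
  "f \<in> carrier (Cc X) \<longleftrightarrow>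
    continuous_map X (discrete_topology UNIV) f \<and> compactin X {x. f x \<noteq> 0}"
proof -
  have eq: "{x \<in> topspace X. f x \<noteq> 0} = {x. f x \<noteq> 0} \<longleftrightarrow> (\<forall>x. x \<notin> topspace X \<longrightarrow> f x = 0)"
    by auto
  have "X closure_of {x \<in> topspace X. f x \<noteq> 0} = {x \<in> topspace X. f x \<noteq> 0}"
    if "continuous_map X (discrete_topology UNIV) f"
    using closedin_preimage_discrete[OF that, of "- {0}"] by (simp add: closure_of_closedin)
  moreover have "\<forall>x. x \<notin> topspace X \<longrightarrow> f x = 0" if "compactin X {x. f x \<noteq> 0}"
    using compactin_subset_topspace[OF that] by auto
  ultimately show ?thesis
    unfolding Cc_def by simp (metis (no_types, lifting) eq)
qed

lemma CcI:
  assumes "continuous_map X (discrete_topology UNIV) f" "compactin X K"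
    and "\<And>x. f x \<noteq> 0 \<Longrightarrow> x \<in> K"
  shows "f \<in> carrier (Cc X)"
proof -
  have "{x. f x \<noteq> 0} = {x \<in> topspace X. f x \<in> - {0}}"
    using assms(3) compactin_subset_topspace[OF assms(2)] by auto
  then have "closedin X {x. f x \<noteq> 0}"
    using closedin_preimage_discrete[OF assms(1)] by metis
  then have "compactin X {x. f x \<noteq> 0}"
    using assms(2,3) by (auto intro: closed_compactin)
  with assms(1) show ?thesis by (simp add: Cc_iff)
qed

lemma Cc_continuous: "f \<in> carrier (Cc X) \<Longrightarrow> continuous_map X (discrete_topology UNIV) f"
  and Cc_compact: "f \<in> carrier (Cc X) \<Longrightarrow> compactin X {x. f x \<noteq> 0}"
  by (simp_all add: Cc_iff)

lemma Cc_support: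
  assumes "f \<in> carrier (Cc X)" "f x \<noteq> 0"
  shows "x \<in> topspace X"
proof -
  have "{x. f x \<noteq> 0} \<subseteq> topspace X"
    by (rule compactin_subset_topspace[OF Cc_compact[OF assms(1)]])
  with assms(2) show ?thesis by auto
qed

lemma Cc_simps [simp]:
  "f \<otimes>\<^bsub>Cc X\<^esub> g = (\<lambda>x. f x + g x)" "\<one>\<^bsub>Cc X\<^esub> = (\<lambda>x. 0)"
  by (simp_all add: Cc_def)

lemma continuous_map_discrete_combine:
  assumes "continuous_map X (discrete_topology UNIV) f" "continuous_map X (discrete_topology UNIV) g"
  shows "continuous_map X (discrete_topology UNIV) (\<lambda>x. h (f x) (g x))"
  unfolding continuous_map_discrete_iff_locally_constant
proof
  fix x assume x: "x \<in> topspace X"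
  obtain U where U: "openin X U" "x \<in> U" "\<And>y. y \<in> U \<Longrightarrow> f y = f x"
    using locally_constant_nbhd[OF assms(1) x] by metis
  obtain V where V: "openin X V" "x \<in> V" "\<And>y. y \<in> V \<Longrightarrow> g y = g x"
    using locally_constant_nbhd[OF assms(2) x] by metis
  have "h (f y) (g y) = h (f x) (g x)" if "y \<in> U \<inter> V" for y
    using U(3)[of y] V(3)[of y] that by (metis IntE)
  moreover have "openin X (U \<inter> V)" "x \<in> U \<inter> V" using U V by auto
  ultimately show "\<exists>U. openin X U \<and> x \<in> U \<and> (\<forall>y \<in> U. h (f y) (g y) = h (f x) (g x))"
    by meson
qed

lemma Cc_combine:
  assumes "f \<in> carrier (Cc X)" "g \<in> carrier (Cc X)" "h 0 0 = 0"
  shows "(\<lambda>x. h (f x) (g x)) \<in> carrier (Cc X)"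
proof (rule CcI)
  show "compactin X ({x. f x \<noteq> 0} \<union> {x. g x \<noteq> 0})"
    using compactin_Un[OF Cc_compact[OF assms(1)] Cc_compact[OF assms(2)]] .
  show "continuous_map X (discrete_topology UNIV) (\<lambda>x. h (f x) (g x))"
    by (rule continuous_map_discrete_combine[OF Cc_continuous[OF assms(1)] Cc_continuous[OF assms(2)]])
  show "x \<in> {x. f x \<noteq> 0} \<union> {x. g x \<noteq> 0}" if "h (f x) (g x) \<noteq> 0" for x
    using assms(3) that by (cases "f x = 0"; cases "g x = 0") auto
qed

lemma Cc_zero: "(\<lambda>x. 0) \<in> carrier (Cc X)"
  by (rule CcI[of _ _ "{}"]) auto

lemma Cc_add: "f \<in> carrier (Cc X) \<Longrightarrow> g \<in> carrier (Cc X) \<Longrightarrow> (\<lambda>x. f x + g x) \<in> carrier (Cc X)"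
  and Cc_diff: "f \<in> carrier (Cc X) \<Longrightarrow> g \<in> carrier (Cc X) \<Longrightarrow> (\<lambda>x. f x - g x) \<in> carrier (Cc X)"
  using Cc_combine[of f X g "(+)"] Cc_combine[of f X g "(-)"] by auto

lemma comm_group_Cc: "comm_group (Cc X)"
proof (rule comm_groupI)
  fix f assume f: "f \<in> carrier (Cc X)"
  show "\<exists>g \<in> carrier (Cc X). g \<otimes>\<^bsub>Cc X\<^esub> f = \<one>\<^bsub>Cc X\<^esub>"
    using Cc_diff[OF Cc_zero f] by (intro bexI[of _ "\<lambda>x. 0 - f x"]) auto
qed (auto simp: Cc_add Cc_zero add_ac)

lemma inv_Cc:
  assumes "f \<in> carrier (Cc X)"
  shows "inv\<^bsub>Cc X\<^esub> f = (\<lambda>x. - f x)"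
proof -
  interpret comm_group "Cc X" by (rule comm_group_Cc)
  have "(\<lambda>x. - f x) \<in> carrier (Cc X)" using Cc_diff[OF Cc_zero assms] by simp
  with assms show ?thesis by (intro inv_equality) auto
qed

section \<open>Local homeomorphisms\<close>

text \<open>
  Continuity and openness are local properties, and an injective continuous open map is a
  homeomorphism onto its image. This form of the definition separates two global
  conditions from the single local one, and each of the three is easy to check for composites
  and products.
\<close>

lemma local_homeomorphism_iff:
  "local_homeomorphism X Y p \<longleftrightarrow> continuous_map X Y p \<and> open_map X Y p \<and>
    (\<forall>x \<in> topspace X. \<exists>U. openin X U \<and> x \<in> U \<and> inj_on p U)"
proof (intro iffI conjI)
  assume p: "local_homeomorphism X Y p"
  show "\<forall>x \<in> topspace X. \<exists>U. openin X U \<and> x \<in> U \<and> inj_on p U"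
  proof
    fix x assume "x \<in> topspace X"
    then obtain U where U: "openin X U" "x \<in> U"
        "homeomorphic_map (subtopology X U) (subtopology Y (p ` U)) p"
      using p unfolding local_homeomorphism_def by blast
    then have "inj_on p U"
      using homeomorphic_imp_injective_map openin_subset by (metis inf.absorb2 topspace_subtopology)
    with U show "\<exists>U. openin X U \<and> x \<in> U \<and> inj_on p U" by blast
  qed
  have nbhd: "\<exists>T. openin X T \<and> x \<in> T \<and> T \<subseteq> {x \<in> topspace X. p x \<in> V}"
    if V: "openin Y V" and x: "x \<in> topspace X" "p x \<in> V" for V x
  proof -
    obtain U where U: "openin X U" "x \<in> U"
        "homeomorphic_map (subtopology X U) (subtopology Y (p ` U)) p"
      using p x unfolding local_homeomorphism_def by blast
    then have "continuous_map (subtopology X U) (subtopology Y (p ` U)) p"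
      by (simp add: homeomorphic_imp_continuous_map)
    then have "continuous_map (subtopology X U) Y p"
      using continuous_map_in_subtopology by blast
    then have "openin (subtopology X U) {x \<in> topspace (subtopology X U). p x \<in> V}"
      using V by (rule openin_continuous_map_preimage)
    then have "openin X {x \<in> topspace (subtopology X U). p x \<in> V}"
      using U(1) openin_trans_full by blast
    with U x show ?thesis
      by (intro exI[of _ "{x \<in> topspace (subtopology X U). p x \<in> V}"]) auto
  qed
  have "p x \<in> topspace Y" if "x \<in> topspace X" for x
    using p that unfolding local_homeomorphism_def by (meson image_eqI openin_subset subsetD)
  moreover have "openin X {x \<in> topspace X. p x \<in> V}" if "openin Y V" for V
    by (subst openin_subopen) (use nbhd[OF that] in blast)
  ultimately show "continuous_map X Y p"
    unfolding continuous_map_def by auto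
  show "open_map X Y p"
    unfolding open_map_def
  proof (intro allI impI)
    fix V assume V: "openin X V"
    have "\<exists>T. openin Y T \<and> p x \<in> T \<and> T \<subseteq> p ` V" if x: "x \<in> V" for x
    proof -
      obtain U where U: "openin X U" "x \<in> U" "openin Y (p ` U)"
          "homeomorphic_map (subtopology X U) (subtopology Y (p ` U)) p"
        using p openin_subset[OF V] x unfolding local_homeomorphism_def by (meson subsetD)
      have "openin (subtopology X U) (U \<inter> V)"
        using V by (simp add: openin_subtopology_Int2)
      then have "openin (subtopology Y (p ` U)) (p ` (U \<inter> V))"
        using U(4) by (meson homeomorphic_imp_open_map open_map_def)
      then have "openin Y (p ` (U \<inter> V))"
        using U(3) openin_trans_full by blast
      with U x show ?thesis by (intro exI[of _ "p ` (U \<inter> V)"]) auto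
    qed
    then show "openin Y (p ` V)" by (subst openin_subopen) blast
  qed
next
  assume p: "continuous_map X Y p \<and> open_map X Y p \<and>
    (\<forall>x \<in> topspace X. \<exists>U. openin X U \<and> x \<in> U \<and> inj_on p U)"
  show "local_homeomorphism X Y p"
    unfolding local_homeomorphism_def
  proof
    fix x assume "x \<in> topspace X"
    then obtain U where U: "openin X U" "x \<in> U" "inj_on p U" using p by blast
    have oU: "openin Y (p ` U)" using p U by (simp add: open_map_def)
    have "homeomorphic_map (subtopology X U) (subtopology Y (p ` U)) p"
    proof (rule bijective_open_imp_homeomorphic_map)
      show "continuous_map (subtopology X U) (subtopology Y (p ` U)) p"
        using p by (simp add: continuous_map_in_subtopology continuous_map_from_subtopology)
      show "open_map (subtopology X U) (subtopology Y (p ` U)) p"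
        unfolding open_map_def
      proof (intro allI impI)
        fix V assume "openin (subtopology X U) V"
        then have "openin X V" "V \<subseteq> U" using U(1) openin_open_subtopology by blast+
        then show "openin (subtopology Y (p ` U)) (p ` V)"
          using p oU by (simp add: open_map_def openin_open_subtopology image_mono)
      qed
    qed (use U openin_subset[OF U(1)] openin_subset[OF oU] in \<open>auto simp: inf.absorb2\<close>)
    with U oU show "\<exists>U. openin X U \<and> x \<in> U \<and> openin Y (p ` U) \<and>
        homeomorphic_map (subtopology X U) (subtopology Y (p ` U)) p"
      by blast
  qed
qed

lemma local_homeomorphism_compose:
  assumes p: "local_homeomorphism X Y p" and q: "local_homeomorphism Y Z q"
  shows "local_homeomorphism X Z (q \<circ> p)"
  unfolding local_homeomorphism_iff
proof (intro conjI ballI)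
  have cp: "continuous_map X Y p" using p by (simp add: local_homeomorphism_iff)
  fix x assume x: "x \<in> topspace X"
  then have "p x \<in> topspace Y" using cp continuous_map_funspace by fastforce
  then obtain V where V: "openin Y V" "p x \<in> V" "inj_on q V"
    using q by (auto simp: local_homeomorphism_iff)
  obtain U where U: "openin X U" "x \<in> U" "inj_on p U"
    using p x by (auto simp: local_homeomorphism_iff)
  have "openin X {x \<in> topspace X. p x \<in> V}"
    using cp V(1) by (rule openin_continuous_map_preimage)
  with U V x show "\<exists>U. openin X U \<and> x \<in> U \<and> inj_on (q \<circ> p) U"
    by (intro exI[of _ "U \<inter> {x \<in> topspace X. p x \<in> V}"]) (auto simp: inj_on_def)
next
  show "continuous_map X Z (q \<circ> p)" "open_map X Z (q \<circ> p)"
    using p q unfolding local_homeomorphism_iff by (meson continuous_map_compose open_map_compose)+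
qed

lemma homeomorphic_map_imp_local_homeomorphism:
  assumes "homeomorphic_map X Y p"
  shows "local_homeomorphism X Y p"
  unfolding local_homeomorphism_iff
  using homeomorphic_imp_continuous_map[OF assms] homeomorphic_imp_open_map[OF assms]
    homeomorphic_imp_injective_map[OF assms] openin_topspace by blast

lemma local_homeomorphism_map_prod_id:
  assumes p: "local_homeomorphism X Y p"
  shows "local_homeomorphism (prod_topology X Z) (prod_topology Y Z) (map_prod p id)"
  unfolding local_homeomorphism_iff
proof (intro conjI ballI)
  have "continuous_map (prod_topology X Z) (prod_topology Y Z) (\<lambda>(x, y). (p x, id y))"
    using p by (intro continuous_map_prod_top[THEN iffD2]) (auto simp: local_homeomorphism_iff)
  then show "continuous_map (prod_topology X Z) (prod_topology Y Z) (map_prod p id)"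
    by (simp add: map_prod_def)
  show "open_map (prod_topology X Z) (prod_topology Y Z) (map_prod p id)"
    unfolding open_map_def
  proof (intro allI impI)
    fix W assume W: "openin (prod_topology X Z) W"
    show "openin (prod_topology Y Z) (map_prod p id ` W)"
      unfolding openin_prod_topology_alt
    proof clarsimp
      fix x z assume "(x, z) \<in> W"
      then obtain U V where UV: "openin X U" "openin Z V" "x \<in> U" "z \<in> V" "U \<times> V \<subseteq> W"
        using W unfolding openin_prod_topology_alt by meson
      moreover have "openin Y (p ` U)"
        using p UV(1) by (simp add: local_homeomorphism_iff open_map_def)
      moreover have "p ` U \<times> V \<subseteq> map_prod p id ` W" using UV(5) by force
      ultimately show "\<exists>U. openin Y U \<and> (\<exists>V. openin Z V \<and> p x \<in> U \<and> z \<in> V \<and> U \<times> V \<subseteq> map_prod p id ` W)"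
        by blast
    qed
  qed
  fix w assume "w \<in> topspace (prod_topology X Z)"
  then obtain U where "openin X U" "fst w \<in> U" "inj_on p U" "snd w \<in> topspace Z"
    using p by (auto simp: local_homeomorphism_iff)
  then show "\<exists>U. openin (prod_topology X Z) U \<and> w \<in> U \<and> inj_on (map_prod p id) U"
    by (intro exI[of _ "U \<times> topspace Z"]) (auto simp: openin_prod_Times_iff inj_on_def mem_Times_iff)
qed

lemma local_homeomorphism_fst:
  "local_homeomorphism (prod_topology X (discrete_topology UNIV)) X fst"
  unfolding local_homeomorphism_iff
proof (intro conjI ballI)
  fix w :: "'a \<times> 'b" assume "w \<in> topspace (prod_topology X (discrete_topology UNIV))"
  then show "\<exists>U. openin (prod_topology X (discrete_topology UNIV)) U \<and> w \<in> U \<and> inj_on fst U"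
    by (intro exI[of _ "topspace X \<times> {snd w}"]) (auto simp: openin_prod_Times_iff inj_on_def)
qed (simp_all add: continuous_map_fst open_map_fst)

lemma local_homeomorphism_slice:
  "local_homeomorphism X (prod_topology X (discrete_topology UNIV)) (\<lambda>x. (x, n))"
  unfolding local_homeomorphism_iff
proof (intro conjI ballI)
  show "open_map X (prod_topology X (discrete_topology UNIV)) (\<lambda>x. (x, n))"
    unfolding open_map_def
  proof (intro allI impI)
    fix U assume "openin X U"
    moreover have "(\<lambda>x. (x, n)) ` U = U \<times> {n}" by auto
    ultimately show "openin (prod_topology X (discrete_topology UNIV)) ((\<lambda>x. (x, n)) ` U)"
      by (simp add: openin_prod_Times_iff)
  qed
  show "\<exists>U. openin X U \<and> x \<in> U \<and> inj_on (\<lambda>x. (x, n)) U" if "x \<in> topspace X" for x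
    using that by (intro exI[of _ "topspace X"]) (auto simp: inj_on_def)
qed (auto simp: continuous_map_pairwise o_def)

text \<open>
  Both the range map of a skew product, with \<open>d\<close> the degree, and the shift, with \<open>d = 1\<close>, are
  built from such a shear. Its inverse is the shear along \<open>-d\<close>.
\<close>

lemma homeomorphic_map_shear:
  assumes d: "continuous_map X (discrete_topology UNIV) (d :: 'a \<Rightarrow> int)"
  shows "homeomorphic_map (prod_topology X (discrete_topology UNIV))
    (prod_topology X (discrete_topology UNIV)) (\<lambda>(x, n). (x, d x + n))"
proof -
  let ?P = "prod_topology X (discrete_topology (UNIV :: int set))"
  have cont: "continuous_map ?P ?P (\<lambda>w. (fst w, h (d (fst w)) (snd w)))" for h
  proof -
    have "continuous_map ?P (discrete_topology UNIV) (\<lambda>w. d (fst w))"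
      using continuous_map_compose[OF continuous_map_fst d] by (simp add: o_def)
    then have "continuous_map ?P (discrete_topology UNIV) (\<lambda>w. h (d (fst w)) (snd w))"
      by (rule continuous_map_discrete_combine[OF _ continuous_map_snd])
    then show ?thesis
      by (rule continuous_map_pairedI[OF continuous_map_fst])
  qed
  have "homeomorphic_maps ?P ?P (\<lambda>w. (fst w, d (fst w) + snd w)) (\<lambda>w. (fst w, snd w - d (fst w)))"
    unfolding homeomorphic_maps_def
  proof (intro conjI)
    show "continuous_map ?P ?P (\<lambda>w. (fst w, d (fst w) + snd w))" by (rule cont)
    show "continuous_map ?P ?P (\<lambda>w. (fst w, snd w - d (fst w)))" by (rule cont[of "\<lambda>a b. b - a"])
  qed simp_all
  then have "homeomorphic_map ?P ?P (\<lambda>w. (fst w, d (fst w) + snd w))"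
    by (rule homeomorphic_maps_imp_map)
  then show ?thesis by (simp add: case_prod_beta')
qed

section \<open>Pushforward\<close>

text \<open>
  The fibre is not intersected with the domain of \<open>p\<close>, because functions in \<open>Cc X\<close> vanish
  outside \<open>X\<close>. This way the pushforward depends on no topology.
\<close>

definition pushforward :: "('a \<Rightarrow> 'b) \<Rightarrow> ('a \<Rightarrow> int) \<Rightarrow> 'b \<Rightarrow> int" where
  "pushforward p f y = (\<Sum>x | p x = y \<and> f x \<noteq> 0. f x)"

lemma pushforward_nonzero: "pushforward p f y \<noteq> 0 \<Longrightarrow> \<exists>x. p x = y \<and> f x \<noteq> 0"
  unfolding pushforward_def using sum.not_neutral_contains_not_neutral by fastforce

text \<open>
  Finitely many open sets on which \<open>p\<close> is injective cover the compact support of \<open>f\<close>, and each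
  of them meets the fibre in at most one point.
\<close>

lemma finite_fibre:
  assumes p: "local_homeomorphism X Y p" and f: "f \<in> carrier (Cc X)"
  shows "finite {x. p x = y \<and> f x \<noteq> 0}"
proof -
  let ?\<U> = "{U. openin X U \<and> inj_on p U}"
  have "\<exists>\<F>. finite \<F> \<and> \<F> \<subseteq> ?\<U> \<and> {x. f x \<noteq> 0} \<subseteq> \<Union>\<F>"
  proof (rule compactinD[OF Cc_compact[OF f]])
    show "{x. f x \<noteq> 0} \<subseteq> \<Union>?\<U>"
      using p Cc_support[OF f] unfolding local_homeomorphism_iff by blast
  qed auto
  then obtain \<F> where \<F>: "finite \<F>" "\<F> \<subseteq> ?\<U>" "{x. f x \<noteq> 0} \<subseteq> \<Union>\<F>" by blast
  have "finite (U \<inter> {x. p x = y})" if "U \<in> \<F>" for U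
  proof (rule finite_imageD)
    show "inj_on p (U \<inter> {x. p x = y})" using \<F>(2) that by (auto simp: inj_on_def)
    have "p ` (U \<inter> {x. p x = y}) \<subseteq> {y}" by auto
    then show "finite (p ` (U \<inter> {x. p x = y}))" using finite_subset by blast
  qed
  then have "finite (\<Union>U\<in>\<F>. U \<inter> {x. p x = y})" using \<F>(1) by blast
  then show ?thesis by (rule rev_finite_subset) (use \<F>(3) in blast)
qed

lemma pushforward_eq_sum:
  assumes "finite S" "\<And>x. p x = y \<Longrightarrow> f x \<noteq> 0 \<Longrightarrow> x \<in> S" "\<And>x. x \<in> S \<Longrightarrow> p x = y"
  shows "pushforward p f y = sum f S"
  unfolding pushforward_def using assms by (intro sum.mono_neutral_left) auto

lemma pushforward_combine:
  assumes p: "local_homeomorphism X Y p"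
    and f: "f \<in> carrier (Cc X)" and g: "g \<in> carrier (Cc X)"
  shows pushforward_add: "pushforward p (\<lambda>x. f x + g x) = (\<lambda>y. pushforward p f y + pushforward p g y)"
    and pushforward_diff: "pushforward p (\<lambda>x. f x - g x) = (\<lambda>y. pushforward p f y - pushforward p g y)"
proof -
  let ?S = "\<lambda>y. {x. p x = y \<and> f x \<noteq> 0} \<union> {x. p x = y \<and> g x \<noteq> 0}"
  have fin: "finite (?S y)" for y using finite_fibre[OF p] f g by blast
  have "pushforward p h y = sum h (?S y)" if "\<And>x. h x \<noteq> 0 \<Longrightarrow> f x \<noteq> 0 \<or> g x \<noteq> 0" for h y
    by (rule pushforward_eq_sum[OF fin]) (use that in auto)
  from this[of "\<lambda>x. f x + g x"] this[of "\<lambda>x. f x - g x"] this[of f] this[of g]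
  show "pushforward p (\<lambda>x. f x + g x) = (\<lambda>y. pushforward p f y + pushforward p g y)"
    and "pushforward p (\<lambda>x. f x - g x) = (\<lambda>y. pushforward p f y - pushforward p g y)"
    by (auto simp: sum.distrib sum_subtractf)
qed

text \<open>
  Fubini for finite sums: the fibre of \<open>q \<circ> p\<close> over \<open>z\<close> is partitioned by the values of \<open>p\<close>.
\<close>

lemma pushforward_compose:
  assumes p: "local_homeomorphism X Y p" and qp: "local_homeomorphism X Z (q \<circ> p)"
    and f: "f \<in> carrier (Cc X)"
  shows "pushforward q (pushforward p f) = pushforward (q \<circ> p) f"
proof
  fix z
  let ?S = "{x. (q \<circ> p) x = z \<and> f x \<noteq> 0}"
  have fin: "finite ?S" by (rule finite_fibre[OF qp f])
  have "pushforward q (pushforward p f) z = sum (pushforward p f) (p ` ?S)"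
    by (rule pushforward_eq_sum) (use fin pushforward_nonzero[of p f] in force)+
  also have "\<dots> = (\<Sum>y\<in>p ` ?S. \<Sum>x | x \<in> ?S \<and> p x = y. f x)"
    unfolding pushforward_def by (intro sum.cong) auto
  also have "\<dots> = sum f ?S" by (rule sum.image_gen[OF fin, symmetric])
  finally show "pushforward q (pushforward p f) z = pushforward (q \<circ> p) f z"
    by (simp add: pushforward_def)
qed

lemma pushforward_id [simp]: "pushforward (\<lambda>x. x) f = f"
proof
  show "pushforward (\<lambda>x. x) f y = f y" for y
    using pushforward_eq_sum[of "{y}" "\<lambda>x. x" y f] by simp
qed

lemma Hausdorff_separate_finite:
  assumes X: "Hausdorff_space X" and F: "finite F" "F \<subseteq> topspace X"
  shows "\<exists>P. (\<forall>a \<in> F. openin X (P a) \<and> a \<in> P a) \<and>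
    (\<forall>a \<in> F. \<forall>b \<in> F. a \<noteq> b \<longrightarrow> P a \<inter> P b = {})"
  using F
proof (induction F rule: finite_induct)
  case (insert x F)
  then obtain P where P: "\<And>a. a \<in> F \<Longrightarrow> openin X (P a) \<and> a \<in> P a"
      "\<And>a b. a \<in> F \<Longrightarrow> b \<in> F \<Longrightarrow> a \<noteq> b \<Longrightarrow> P a \<inter> P b = {}"
    by (metis insert_subset)
  have "compactin X {x}" "compactin X F" "disjnt {x} F"
    using insert by (auto simp: finite_imp_compactin)
  then obtain U V where UV: "openin X U" "openin X V" "{x} \<subseteq> U" "F \<subseteq> V" "disjnt U V"
    using X unfolding Hausdorff_space_compact_sets by meson
  show ?case
    by (intro exI[of _ "\<lambda>a. if a = x then U else P a \<inter> V"])
      (use P UV insert.hyps in \<open>auto simp: disjnt_iff; blast\<close>)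
qed simp

text \<open>
  The support of \<open>pushforward p f\<close> lies in the compact image of the support of \<open>f\<close>, so local
  constancy is the point. Around the finitely many points of the support over \<open>y\<close> choose disjoint
  open sets \<open>W a\<close> on which \<open>p\<close> is injective and \<open>f\<close> is constant. The rest of the support is
  compact and misses the fibre of \<open>y\<close>, so its image is closed and does not contain \<open>y\<close>. Hence for
  \<open>z\<close> near \<open>y\<close> the points of the support over \<open>z\<close> are exactly one in each \<open>W a\<close>, and the two
  fibre sums agree term by term.
\<close>

lemma pushforward_Cc:
  assumes X: "Hausdorff_space X" and Y: "Hausdorff_space Y" and p: "local_homeomorphism X Y p"
    and f: "f \<in> carrier (Cc X)"
  shows "pushforward p f \<in> carrier (Cc Y)"
proof (rule CcI)
  let ?K = "{x. f x \<noteq> 0}"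
  have cp: "continuous_map X Y p" and op: "\<And>U. openin X U \<Longrightarrow> openin Y (p ` U)"
    using p by (auto simp: local_homeomorphism_iff open_map_def)
  show "compactin Y (p ` ?K)" using Cc_compact[OF f] cp by (rule image_compactin)
  show "y \<in> p ` ?K" if "pushforward p f y \<noteq> 0" for y
    using pushforward_nonzero[OF that] by blast
  show "continuous_map Y (discrete_topology UNIV) (pushforward p f)"
    unfolding continuous_map_discrete_iff_locally_constant
  proof
    fix y assume y: "y \<in> topspace Y"
    define F where "F = {x. p x = y \<and> f x \<noteq> 0}"
    have F: "finite F" "F \<subseteq> topspace X"
      unfolding F_def using finite_fibre[OF p f] Cc_support[OF f] by auto
    obtain P where P: "\<And>a. a \<in> F \<Longrightarrow> openin X (P a) \<and> a \<in> P a"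
        "\<And>a b. a \<in> F \<Longrightarrow> b \<in> F \<Longrightarrow> a \<noteq> b \<Longrightarrow> P a \<inter> P b = {}"
      using Hausdorff_separate_finite[OF X F] by metis
    have "\<exists>W. openin X W \<and> a \<in> W \<and> inj_on p W \<and> (\<forall>x \<in> W. f x = f a) \<and> W \<subseteq> P a" if a: "a \<in> F" for a
    proof -
      obtain U where "openin X U" "a \<in> U" "inj_on p U"
        using a F(2) p unfolding local_homeomorphism_iff by (meson subsetD)
      moreover obtain V where "openin X V" "a \<in> V" "\<forall>x \<in> V. f x = f a"
        using locally_constant_nbhd[OF Cc_continuous[OF f]] a F(2) by (meson subsetD)
      ultimately show ?thesis
        using P(1)[OF a] inj_on_subset[of p U "U \<inter> V \<inter> P a"]
        by (intro exI[of _ "U \<inter> V \<inter> P a"]) blast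
    qed
    then obtain W where W: "\<And>a. a \<in> F \<Longrightarrow> openin X (W a)" "\<And>a. a \<in> F \<Longrightarrow> a \<in> W a"
        "\<And>a. a \<in> F \<Longrightarrow> inj_on p (W a)" "\<And>a x. a \<in> F \<Longrightarrow> x \<in> W a \<Longrightarrow> f x = f a"
        "\<And>a. a \<in> F \<Longrightarrow> W a \<subseteq> P a"
      by metis
    define N where "N = (topspace Y \<inter> (\<Inter>a\<in>F. p ` W a)) - p ` (?K - (\<Union>a\<in>F. W a))"
    have "closedin X (?K - (\<Union>a\<in>F. W a))"
      using compactin_imp_closedin[OF X Cc_compact[OF f]] W(1) by (intro closedin_diff) auto
    then have "compactin X (?K - (\<Union>a\<in>F. W a))"
      using Cc_compact[OF f] by (meson Diff_subset closed_compactin)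
    then have "closedin Y (p ` (?K - (\<Union>a\<in>F. W a)))"
      using image_compactin[OF _ cp] compactin_imp_closedin[OF Y] by blast
    moreover have "openin Y (topspace Y \<inter> (\<Inter>a\<in>F. p ` W a))"
      using F(1) W(1) op by (cases "F = {}") (auto intro!: openin_Int openin_INT)
    ultimately have "openin Y N" unfolding N_def by (rule openin_diff[rotated])
    moreover have "y \<in> N"
    proof -
      have "y \<in> p ` W a" if "a \<in> F" for a
        using W(2)[OF that] that by (auto simp: F_def)
      moreover have "y \<notin> p ` (?K - (\<Union>a\<in>F. W a))"
        using W(2) by (auto simp: F_def)
      ultimately show ?thesis using y by (simp add: N_def)
    qed
    moreover have "pushforward p f z = pushforward p f y" if z: "z \<in> N" for z
    proof -
      have "\<exists>x. x \<in> W a \<and> p x = z" if "a \<in> F" for a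
        using z that unfolding N_def by blast
      then obtain \<sigma> where \<sigma>: "\<And>a. a \<in> F \<Longrightarrow> \<sigma> a \<in> W a" "\<And>a. a \<in> F \<Longrightarrow> p (\<sigma> a) = z" by metis
      have f\<sigma>: "f (\<sigma> a) = f a" if "a \<in> F" for a using W(4) \<sigma>(1) that by blast
      have "bij_betw \<sigma> F {x. p x = z \<and> f x \<noteq> 0}"
      proof (rule bij_betw_imageI)
        show "inj_on \<sigma> F"
          by (rule inj_onI) (metis P(2) W(5) \<sigma>(1) disjoint_iff subsetD)
        have "\<sigma> a \<in> {x. p x = z \<and> f x \<noteq> 0}" if "a \<in> F" for a
          using \<sigma>(2) f\<sigma> that by (auto simp: F_def)
        moreover have "x \<in> \<sigma> ` F" if x: "p x = z" "f x \<noteq> 0" for x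
        proof -
          have "x \<in> (\<Union>a\<in>F. W a)" using x z unfolding N_def by blast
          then obtain a where a: "a \<in> F" "x \<in> W a" by blast
          then have "x = \<sigma> a" using W(3)[OF a(1)] \<sigma>[OF a(1)] x(1) by (simp add: inj_on_def)
          then show ?thesis using a by blast
        qed
        ultimately show "\<sigma> ` F = {x. p x = z \<and> f x \<noteq> 0}" by blast
      qed
      then have "pushforward p f z = (\<Sum>a\<in>F. f (\<sigma> a))"
        unfolding pushforward_def by (rule sum.reindex_bij_betw[symmetric])
      also have "\<dots> = pushforward p f y"
        unfolding pushforward_def F_def[symmetric] using f\<sigma> by (intro sum.cong) auto
      finally show ?thesis .
    qed
    ultimately show "\<exists>U. openin Y U \<and> y \<in> U \<and> (\<forall>z \<in> U. pushforward p f z = pushforward p f y)"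
      by blast
  qed
qed

section \<open>Homology of a pair of local homeomorphisms\<close>

text \<open>
  The boundary sees a groupoid through its source and range maps alone. A skew product of such a
  graph is visibly a graph of the same kind, so the ordinary and the graded homology are two
  instances of one construction.
\<close>

locale etale_graph =
  fixes G :: "'a groupoid_data"
  assumes Hausdorff_arrows: "Hausdorff_space (gtop G)"
    and source_local_homeomorphism: "local_homeomorphism (gtop G) (unit_space G) (source G)"
    and range_local_homeomorphism: "local_homeomorphism (gtop G) (unit_space G) (range_map G)"
begin

lemma Hausdorff_units: "Hausdorff_space (unit_space G)"
  unfolding unit_space_def by (rule Hausdorff_space_subtopology[OF Hausdorff_arrows])

lemma boundary_eq_pushforward:
  assumes f: "f \<in> carrier (Cc (gtop G))"
  shows "boundary G f = (\<lambda>x. pushforward (source G) f x - pushforward (range_map G) f x)"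
proof
  fix x
  have fibre: "supp_sum f {g \<in> arrows G. p g = x} = pushforward p f x" for p :: "'a \<Rightarrow> 'a"
    unfolding supp_sum_def support_on_def pushforward_def arrows_def
    using Cc_support[OF f] by (intro sum.cong) auto
  have "pushforward p f x = 0"
    if p: "local_homeomorphism (gtop G) (unit_space G) p" and x: "x \<notin> units G" for p
  proof (rule ccontr)
    assume "pushforward p f x \<noteq> 0"
    then obtain g where "p g = x" "f g \<noteq> 0" using pushforward_nonzero by metis
    moreover have "p ` topspace (gtop G) \<subseteq> topspace (unit_space G)"
      using p unfolding local_homeomorphism_iff by (blast dest: continuous_map_image_subset_topspace)
    ultimately have "x \<in> topspace (unit_space G)" using Cc_support[OF f] by auto
    with x show False by (simp add: unit_space_def)
  qed
  then show "boundary G f x = pushforward (source G) f x - pushforward (range_map G) f x"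
    using source_local_homeomorphism range_local_homeomorphism by (simp add: boundary_def fibre)
qed

lemma boundary_Cc:
  assumes "f \<in> carrier (Cc (gtop G))"
  shows "boundary G f \<in> carrier (Cc (unit_space G))"
  unfolding boundary_eq_pushforward[OF assms]
  by (intro Cc_diff pushforward_Cc[OF Hausdorff_arrows Hausdorff_units _ assms]
      source_local_homeomorphism range_local_homeomorphism)

lemma boundary_add:
  assumes f: "f \<in> carrier (Cc (gtop G))" and g: "g \<in> carrier (Cc (gtop G))"
  shows "boundary G (\<lambda>x. f x + g x) = (\<lambda>x. boundary G f x + boundary G g x)"
  unfolding boundary_eq_pushforward[OF Cc_add[OF f g]] boundary_eq_pushforward[OF f]
    boundary_eq_pushforward[OF g] pushforward_add[OF source_local_homeomorphism f g]
    pushforward_add[OF range_local_homeomorphism f g]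
  by (simp add: algebra_simps)

lemma boundary_diff:
  assumes f: "f \<in> carrier (Cc (gtop G))" and g: "g \<in> carrier (Cc (gtop G))"
  shows "boundary G (\<lambda>x. f x - g x) = (\<lambda>x. boundary G f x - boundary G g x)"
  unfolding boundary_eq_pushforward[OF Cc_diff[OF f g]] boundary_eq_pushforward[OF f]
    boundary_eq_pushforward[OF g] pushforward_diff[OF source_local_homeomorphism f g]
    pushforward_diff[OF range_local_homeomorphism f g]
  by (simp add: algebra_simps)

lemma boundaries_subgroup: "subgroup (boundaries G) (Cc (unit_space G))"
proof -
  have "group_hom (Cc (gtop G)) (Cc (unit_space G)) (boundary G)"
    using comm_group_Cc[THEN comm_group.axioms(2)]
    by (auto simp: group_hom_def group_hom_axioms_def hom_def boundary_Cc boundary_add)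
  then show ?thesis unfolding boundaries_def by (rule group_hom.img_is_subgroup)
qed

lemma boundaries_normal: "normal (boundaries G) (Cc (unit_space G))"
  using comm_group_Cc boundaries_subgroup by (rule comm_group.subgroup_imp_normal)

lemma comm_group_H0: "comm_group (H0 G)"
  unfolding H0_def by (rule comm_group.abelian_FactGroup[OF comm_group_Cc boundaries_subgroup])

lemma carrier_H0: "carrier (H0 G) = homology_class G ` carrier (Cc (unit_space G))"
  unfolding H0_def carrier_FactGroup homology_class_def ..

lemma homology_class_add:
  assumes "f \<in> carrier (Cc (unit_space G))" "g \<in> carrier (Cc (unit_space G))"
  shows "homology_class G f \<otimes>\<^bsub>H0 G\<^esub> homology_class G g = homology_class G (\<lambda>x. f x + g x)"
  using normal.rcos_sum[OF boundaries_normal assms] by (simp add: H0_def homology_class_def)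

lemma homology_class_eq_iff:
  assumes f: "f \<in> carrier (Cc (unit_space G))" and g: "g \<in> carrier (Cc (unit_space G))"
  shows "homology_class G f = homology_class G g \<longleftrightarrow> (\<lambda>x. f x - g x) \<in> boundaries G"
proof -
  interpret comm_group "Cc (unit_space G)" by (rule comm_group_Cc)
  interpret subgroup "boundaries G" "Cc (unit_space G)" by (rule boundaries_subgroup)
  have "homology_class G f = homology_class G g \<longleftrightarrow> f \<in> homology_class G g"
    unfolding homology_class_def
    using repr_independence repr_independenceD boundaries_subgroup f g by metis
  also have "\<dots> \<longleftrightarrow> (\<lambda>x. f x - g x) \<in> boundaries G"
    unfolding homology_class_def using rcos_module[OF is_group g f] by (simp add: inv_Cc[OF g])
  finally show ?thesis .
qed

lemma one_H0: "\<one>\<^bsub>H0 G\<^esub> = homology_class G (\<lambda>x. 0)"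
proof -
  interpret comm_group "Cc (unit_space G)" by (rule comm_group_Cc)
  show ?thesis
    using coset_join2[OF _ boundaries_subgroup, of "\<lambda>x. 0"] subgroup.one_closed[OF boundaries_subgroup]
    by (simp add: H0_def homology_class_def Cc_zero)
qed

lemma homology_class_eq_one_iff:
  assumes "f \<in> carrier (Cc (unit_space G))"
  shows "homology_class G f = \<one>\<^bsub>H0 G\<^esub> \<longleftrightarrow> f \<in> boundaries G"
  unfolding one_H0 homology_class_eq_iff[OF assms Cc_zero] by simp

end

text \<open>
  The hypotheses under which a map of function groups descends to homology: it is additive and
  sends boundaries to boundaries.
\<close>

locale H0_morphism = G: etale_graph G + K: etale_graph K
  for G :: "'a groupoid_data" and K :: "'b groupoid_data" +
  fixes \<phi> :: "('a \<Rightarrow> int) \<Rightarrow> ('b \<Rightarrow> int)"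
  assumes map_Cc: "f \<in> carrier (Cc (unit_space G)) \<Longrightarrow> \<phi> f \<in> carrier (Cc (unit_space K))"
    and map_add: "f \<in> carrier (Cc (unit_space G)) \<Longrightarrow> g \<in> carrier (Cc (unit_space G)) \<Longrightarrow>
      \<phi> (\<lambda>x. f x + g x) = (\<lambda>x. \<phi> f x + \<phi> g x)"
    and map_boundaries: "f \<in> carrier (Cc (gtop G)) \<Longrightarrow> \<phi> (boundary G f) \<in> boundaries K"
begin

lemma induced_map_class:
  assumes f: "f \<in> carrier (Cc (unit_space G))"
  shows "induced_map K \<phi> (homology_class G f) = homology_class K (\<phi> f)"
proof -
  interpret comm_group "Cc (unit_space G)" by (rule comm_group_Cc)
  have "homology_class K (\<phi> g) = homology_class K (\<phi> f)" if "g \<in> homology_class G f" for g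
  proof -
    obtain h where h: "h \<in> carrier (Cc (gtop G))" and g: "g = (\<lambda>x. boundary G h x + f x)"
      using \<open>g \<in> homology_class G f\<close> unfolding homology_class_def r_coset_def boundaries_def by auto
    have bh: "boundary G h \<in> carrier (Cc (unit_space G))" using h by (rule G.boundary_Cc)
    have "(\<lambda>x. \<phi> g x - \<phi> f x) = \<phi> (boundary G h)" unfolding g map_add[OF bh f] by simp
    then show ?thesis
      using K.homology_class_eq_iff[OF map_Cc[OF Cc_add[OF bh f]] map_Cc[OF f]] map_boundaries[OF h]
      by (simp add: g)
  qed
  moreover have "f \<in> homology_class G f"
    unfolding homology_class_def by (rule rcos_self[OF f G.boundaries_subgroup])
  ultimately have "(\<lambda>g. homology_class K (\<phi> g)) ` homology_class G f = {homology_class K (\<phi> f)}"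
    by blast
  then show ?thesis by (simp add: induced_map_def)
qed

lemma group_hom_induced_map: "group_hom (H0 G) (H0 K) (induced_map K \<phi>)"
  unfolding group_hom_def group_hom_axioms_def hom_def
proof (intro conjI CollectI ballI)
  show "group (H0 G)" "group (H0 K)"
    using G.comm_group_H0 K.comm_group_H0 comm_group.axioms(2) by blast+
  show "induced_map K \<phi> \<in> carrier (H0 G) \<rightarrow> carrier (H0 K)"
    unfolding G.carrier_H0 K.carrier_H0 using induced_map_class map_Cc by auto
  fix X Y assume "X \<in> carrier (H0 G)" "Y \<in> carrier (H0 G)"
  then obtain f g where fg: "f \<in> carrier (Cc (unit_space G))" "g \<in> carrier (Cc (unit_space G))"
      and XY: "X = homology_class G f" "Y = homology_class G g"
    unfolding G.carrier_H0 by blast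
  show "induced_map K \<phi> (X \<otimes>\<^bsub>H0 G\<^esub> Y) = induced_map K \<phi> X \<otimes>\<^bsub>H0 K\<^esub> induced_map K \<phi> Y"
    unfolding XY G.homology_class_add[OF fg] induced_map_class[OF Cc_add[OF fg]]
      induced_map_class[OF fg(1)] induced_map_class[OF fg(2)] map_add[OF fg]
    by (rule K.homology_class_add[symmetric]) (intro map_Cc fg)+
qed

end

text \<open>
  Naturality of the boundary under maps of graphs that are local homeomorphisms on arrows and
  on units. Both sides are differences of pushforwards along the composites
  \<open>\<beta> \<circ> s = s \<circ> \<alpha>\<close> and \<open>\<beta> \<circ> r = r \<circ> \<alpha>\<close>.
\<close>

lemma pushforward_boundary:
  assumes G: "etale_graph G" and K: "etale_graph K"
    and \<alpha>: "local_homeomorphism (gtop G) (gtop K) \<alpha>"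
    and \<beta>: "local_homeomorphism (unit_space G) (unit_space K) \<beta>"
    and source: "\<beta> \<circ> source G = source K \<circ> \<alpha>"
    and range: "\<beta> \<circ> range_map G = range_map K \<circ> \<alpha>"
    and f: "f \<in> carrier (Cc (gtop G))"
  shows "pushforward \<beta> (boundary G f) = boundary K (pushforward \<alpha> f)"
proof -
  interpret G: etale_graph G by fact
  interpret K: etale_graph K by fact
  have commute: "pushforward \<beta> (pushforward p f) = pushforward q (pushforward \<alpha> f)"
    if p: "local_homeomorphism (gtop G) (unit_space G) p" and q: "local_homeomorphism (gtop K) (unit_space K) q"
      and "\<beta> \<circ> p = q \<circ> \<alpha>" for p q
    using pushforward_compose[OF p local_homeomorphism_compose[OF p \<beta>] f]
      pushforward_compose[OF \<alpha> local_homeomorphism_compose[OF \<alpha> q] f] that(3) by simp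
  have push: "pushforward p f \<in> carrier (Cc (unit_space G))"
    if "local_homeomorphism (gtop G) (unit_space G) p" for p
    using pushforward_Cc[OF G.Hausdorff_arrows G.Hausdorff_units that f] .
  have \<alpha>f: "pushforward \<alpha> f \<in> carrier (Cc (gtop K))"
    by (rule pushforward_Cc[OF G.Hausdorff_arrows K.Hausdorff_arrows \<alpha> f])
  show ?thesis
    unfolding G.boundary_eq_pushforward[OF f] K.boundary_eq_pushforward[OF \<alpha>f]
      pushforward_diff[OF \<beta> push push, OF G.source_local_homeomorphism G.range_local_homeomorphism]
      commute[OF G.source_local_homeomorphism K.source_local_homeomorphism source]
      commute[OF G.range_local_homeomorphism K.range_local_homeomorphism range] ..
qed

section \<open>Groupoids and skew products\<close>

lemma local_homeomorphism_cong:
  assumes p: "local_homeomorphism X Y p" and eq: "\<And>x. x \<in> topspace X \<Longrightarrow> p x = q x"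
  shows "local_homeomorphism X Y q"
proof -
  have agree: "q x = p x" if "openin X U" "x \<in> U" for U x
    using openin_subset[OF that(1)] that(2) eq by fastforce
  have image: "q ` U = p ` U" if "openin X U" for U
    by (rule image_cong[OF refl agree[OF that]])
  have inj: "inj_on q U = inj_on p U" if "openin X U" for U
    by (rule inj_on_cong[OF agree[OF that]])
  show ?thesis
    unfolding local_homeomorphism_iff
  proof (intro conjI ballI)
    show "continuous_map X Y q"
      using p by (intro continuous_map_eq[OF _ eq]) (simp_all add: local_homeomorphism_iff)
    show "open_map X Y q"
      using p image by (simp add: local_homeomorphism_iff open_map_def)
    show "\<exists>U. openin X U \<and> x \<in> U \<and> inj_on q U" if "x \<in> topspace X" for x
      using p inj that unfolding local_homeomorphism_iff by meson
  qed
qed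

text \<open>
  The range map is the source map after inversion, and inversion is a homeomorphism.
\<close>

lemma etale_groupoid_imp_etale_graph:
  assumes "etale_groupoid G"
  shows "etale_graph G"
proof
  interpret etale_groupoid G by fact
  show "Hausdorff_space (gtop G)" by (rule Hausdorff)
  show "local_homeomorphism (gtop G) (unit_space G) (source G)" by (rule etale)
  have inv: "homeomorphic_map (gtop G) (gtop G) (ginv G)"
    by (rule homeomorphic_maps_imp_map[where g = "ginv G"])
      (use continuous_inv inv_inv in \<open>auto simp: homeomorphic_maps_def arrows_def\<close>)
  have lh: "local_homeomorphism (gtop G) (unit_space G) (source G \<circ> ginv G)"
    by (rule local_homeomorphism_compose[OF homeomorphic_map_imp_local_homeomorphism[OF inv] etale])
  show "local_homeomorphism (gtop G) (unit_space G) (range_map G)"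
    by (rule local_homeomorphism_cong[OF lh]) (simp add: range_map_def source_def arrows_def inv_inv)
qed

lemma gtop_skew_product: "gtop (skew_product G c) = prod_topology (gtop G) (discrete_topology UNIV)"
  by (simp add: skew_product_def)

lemma unit_space_skew_product:
  "unit_space (skew_product G c) = prod_topology (unit_space G) (discrete_topology UNIV)"
  by (simp add: unit_space_def gtop_skew_product subtopology_Times)

text \<open>
  The source is \<open>s \<times> id\<close>, and the range is the shear \<open>(x, n) \<mapsto> (x, c x + n)\<close> followed by
  \<open>r \<times> id\<close>. The shear is a homeomorphism because the degree is continuous.
\<close>

lemma etale_graph_skew_product:
  assumes G: "etale_graph G" and c: "continuous_map (gtop G) (discrete_topology UNIV) c"
  shows "etale_graph (skew_product G c)"
proof
  interpret etale_graph G by fact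
  show "Hausdorff_space (gtop (skew_product G c))"
    by (simp add: gtop_skew_product Hausdorff_space_prod_topology Hausdorff_arrows)
  have s: "source (skew_product G c) = map_prod (source G) id" by (auto simp: fun_eq_iff)
  show "local_homeomorphism (gtop (skew_product G c)) (unit_space (skew_product G c))
      (source (skew_product G c))"
    unfolding s gtop_skew_product unit_space_skew_product
    by (rule local_homeomorphism_map_prod_id[OF source_local_homeomorphism])
  have r: "range_map (skew_product G c) = map_prod (range_map G) id \<circ> (\<lambda>(x, n). (x, c x + n))"
    by (auto simp: fun_eq_iff)
  show "local_homeomorphism (gtop (skew_product G c)) (unit_space (skew_product G c))
      (range_map (skew_product G c))"
    unfolding r gtop_skew_product unit_space_skew_product
    by (rule local_homeomorphism_compose[OF
          homeomorphic_map_imp_local_homeomorphism[OF homeomorphic_map_shear[OF c]]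
          local_homeomorphism_map_prod_id[OF range_local_homeomorphism]])
qed

abbreviation shift :: "'a \<times> int \<Rightarrow> 'a \<times> int" where
  "shift \<equiv> \<lambda>(x, n). (x, 1 + n)"

lemma local_homeomorphism_shift:
  "local_homeomorphism (prod_topology X (discrete_topology UNIV)) (prod_topology X (discrete_topology UNIV)) shift"
  by (rule homeomorphic_map_imp_local_homeomorphism[OF homeomorphic_map_shear[where d = "\<lambda>_. 1"]]) simp

lemma Lambda_eq_pushforward: "Lambda f = (\<lambda>w. pushforward shift f w - f w)"
proof
  fix w :: "'a \<times> int"
  obtain x i where w: "w = (x, i)" by fastforce
  have "pushforward shift f (x, i) = f (x, i - 1)"
    by (subst pushforward_eq_sum[of "{(x, i - 1)}"]) auto
  then show "Lambda f w = pushforward shift f w - f w" by (simp add: w Lambda_def component_def)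
qed

lemma Sigma_sum_eq_pushforward: "Sigma_sum f = pushforward fst f"
proof
  fix x
  have "{w. fst w = x \<and> f w \<noteq> 0} = Pair x ` {i. f (x, i) \<noteq> 0}" by force
  then show "Sigma_sum f x = pushforward fst f x"
    by (simp add: Sigma_sum_def supp_sum_def support_on_def component_def pushforward_def
        sum.reindex inj_on_def)
qed

section \<open>Exactness on the level of functions\<close>

lemma Sigma_sum_Lambda:
  assumes f: "f \<in> carrier (Cc (prod_topology X (discrete_topology UNIV)))"
    and X: "Hausdorff_space X"
  shows "Sigma_sum (Lambda f) = (\<lambda>x. 0)"
proof -
  let ?P = "prod_topology X (discrete_topology (UNIV :: int set))"
  have P: "Hausdorff_space ?P" using X by (simp add: Hausdorff_space_prod_topology)
  have fs: "fst \<circ> shift = (fst :: 'a \<times> int \<Rightarrow> 'a)" by auto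
  have "pushforward fst (pushforward shift f) = pushforward fst f"
    using pushforward_compose[OF local_homeomorphism_shift _ f, of X fst] local_homeomorphism_fst[of X]
    unfolding fs by blast
  then show ?thesis
    unfolding Sigma_sum_eq_pushforward Lambda_eq_pushforward
      pushforward_diff[OF local_homeomorphism_fst pushforward_Cc[OF P P local_homeomorphism_shift f] f]
    by simp
qed

lemma continuous_map_discrete_sum:
  assumes "finite S" "\<And>j. j \<in> S \<Longrightarrow> continuous_map X (discrete_topology UNIV) (f j)"
  shows "continuous_map X (discrete_topology UNIV) (\<lambda>x. \<Sum>j\<in>S. f j x :: int)"
  using assms
proof (induction S rule: finite_induct)
  case (insert j S)
  then have "continuous_map X (discrete_topology UNIV) (\<lambda>x. f j x + (\<Sum>j\<in>S. f j x))"
    by (intro continuous_map_discrete_combine[of X "f j" "\<lambda>x. \<Sum>j\<in>S. f j x" "(+)"]) auto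
  with insert.hyps show ?case by simp
qed simp

text \<open>
  The equation \<open>g(x, i - 1) - g(x, i) = f(x, i)\<close> telescopes to \<open>g(x, i) = (\<Sum>j>i. f(x, j))\<close>. By
  compactness \<open>f\<close> lives in finitely many degrees, so the sum is finite and \<open>g\<close> vanishes in high
  degrees. In low degrees \<open>g\<close> equals \<open>\<Sigma> f\<close>, and \<open>\<Sigma> f = 0\<close> is precisely what makes its support
  compact.
\<close>

lemma Sigma_sum_zero_imp_Lambda:
  assumes f: "f \<in> carrier (Cc (prod_topology X (discrete_topology UNIV)))"
    and zero: "Sigma_sum f = (\<lambda>x. 0)"
  shows "\<exists>g \<in> carrier (Cc (prod_topology X (discrete_topology UNIV))). Lambda g = f"
proof -
  let ?D = "discrete_topology (UNIV :: int set)"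
  let ?P = "prod_topology X ?D"
  let ?K = "{w. f w \<noteq> 0}"
  have K: "compactin ?P ?K" by (rule Cc_compact[OF f])
  have "finite (snd ` ?K)"
    using image_compactin[OF K continuous_map_snd] by (simp add: compactin_discrete_topology)
  then have "bdd_above (abs ` snd ` ?K)" by (rule bdd_above_finite[OF finite_imageI])
  then obtain N where "\<And>k. k \<in> abs ` snd ` ?K \<Longrightarrow> k \<le> N" unfolding bdd_above_def by blast
  then have N: "\<And>x j. f (x, j) \<noteq> 0 \<Longrightarrow> \<bar>j\<bar> \<le> N" by force
  define g where "g = (\<lambda>(x, i). \<Sum>j\<in>{i<..N}. f (x, j))"
  have "Lambda g = f"
  proof
    fix w :: "'a \<times> int"
    obtain x i where w: "w = (x, i)" by fastforce
    show "Lambda g w = f w"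
    proof (cases "i \<le> N")
      case True
      then have "{i - 1<..N} = insert i {i<..N}" by auto
      then show ?thesis by (simp add: w Lambda_def component_def g_def)
    next
      case False
      then have "f (x, i) = 0" using N[of x i] by fastforce
      with False show ?thesis by (simp add: w Lambda_def component_def g_def)
    qed
  qed
  moreover have "g \<in> carrier (Cc ?P)"
  proof (rule CcI)
    have "compactin X (fst ` ?K)" using K by (rule image_compactin[OF _ continuous_map_fst])
    then show "compactin ?P (fst ` ?K \<times> {-N..N})"
      by (simp add: compactin_Times compactin_discrete_topology)
    show "w \<in> fst ` ?K \<times> {-N..N}" if "g w \<noteq> 0" for w
    proof -
      obtain x i where w: "w = (x, i)" by fastforce
      have nz: "(\<Sum>j\<in>{i<..N}. f (x, j)) \<noteq> 0" using that by (simp add: w g_def)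
      then obtain j where j: "j \<in> {i<..N}" "f (x, j) \<noteq> 0" by (meson sum.neutral)
      \<comment> \<open>Below degree \<open>-N\<close> the partial sum is already the full sum, which is zero.\<close>
      have "- N \<le> i"
      proof (rule ccontr)
        assume "\<not> - N \<le> i"
        then have "(\<Sum>j\<in>{i<..N}. f (x, j)) = (\<Sum>j | f (x, j) \<noteq> 0. f (x, j))"
          using N[of x] by (intro sum.mono_neutral_right) force+
        also have "\<dots> = Sigma_sum f x"
          by (simp add: Sigma_sum_def supp_sum_def support_on_def component_def)
        finally show False using nz zero by simp
      qed
      then show ?thesis using j by (force simp: w)
    qed
    show "continuous_map ?P (discrete_topology UNIV) g"
      unfolding continuous_map_discrete_iff_locally_constant
    proof
      fix w assume w: "w \<in> topspace ?P"
      have "continuous_map X (discrete_topology UNIV) (\<lambda>x. f (x, j))" for j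
        using continuous_map_compose[of X ?P "\<lambda>x. (x, j)" _ f] local_homeomorphism_slice[of X j]
          Cc_continuous[OF f] by (simp add: local_homeomorphism_iff o_def)
      then have "continuous_map X (discrete_topology UNIV) (\<lambda>x. \<Sum>j\<in>{snd w<..N}. f (x, j))"
        by (rule continuous_map_discrete_sum[OF finite_greaterThanAtMost_int])
      then have F: "continuous_map X (discrete_topology UNIV) (\<lambda>x. g (x, snd w))"
        by (simp add: g_def)
      have "fst w \<in> topspace X" using w by (simp add: mem_Times_iff)
      from locally_constant_nbhd[OF F this] obtain U where U: "openin X U" "fst w \<in> U"
        and const: "\<forall>x \<in> U. g (x, snd w) = g (fst w, snd w)"
        by (elim exE conjE)
      have "openin ?P (U \<times> {snd w})" using U(1) by (simp add: openin_prod_Times_iff)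
      moreover have "w \<in> U \<times> {snd w}" using U(2) by (simp add: mem_Times_iff)
      moreover have "g v = g w" if "v \<in> U \<times> {snd w}" for v
        using bspec[OF const, of "fst v"] that by (metis mem_Times_iff prod.collapse singletonD)
      ultimately show "\<exists>V. openin ?P V \<and> w \<in> V \<and> (\<forall>v \<in> V. g v = g w)"
        by (intro exI[of _ "U \<times> {snd w}"] conjI ballI)
    qed
  qed
  ultimately show ?thesis by blast
qed

lemma Sigma_sum_slice:
  assumes f: "f \<in> carrier (Cc X)"
  shows "Sigma_sum (pushforward (\<lambda>x. (x, n)) f) = f"
proof -
  have "fst \<circ> (\<lambda>x. (x, n)) = (\<lambda>x :: 'a. x)" by auto
  then show ?thesis
    using pushforward_compose[OF local_homeomorphism_slice local_homeomorphism_compose[OF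
          local_homeomorphism_slice local_homeomorphism_fst] f, of n]
    unfolding Sigma_sum_eq_pushforward by (simp only: pushforward_id)
qed

section \<open>The exact sequence\<close>

theorem theorem5p7:
  fixes G :: "'a groupoid_data" and c :: "'a \<Rightarrow> int"
  assumes "ample_groupoid G" and "graded_groupoid G c"
  shows "comm_group (H0_gr G c) \<and> comm_group (H0 G) \<and>
    group_hom (H0_gr G c) (H0_gr G c) (Lambda_tilde G c) \<and>
    group_hom (H0_gr G c) (H0 G) (Sigma_tilde G) \<and>
    (\<forall>f \<in> carrier (Cc (unit_space (skew_product G c))).
      Lambda f \<in> carrier (Cc (unit_space (skew_product G c))) \<and>
      Lambda_tilde G c (homology_class (skew_product G c) f)
        = homology_class (skew_product G c) (Lambda f) \<and>
      Sigma_sum f \<in> carrier (Cc (unit_space G)) \<and>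
      Sigma_tilde G (homology_class (skew_product G c) f) = homology_class G (Sigma_sum f)) \<and>
    Lambda_tilde G c ` carrier (H0_gr G c) = kernel (H0_gr G c) (H0 G) (Sigma_tilde G) \<and>
    Sigma_tilde G ` carrier (H0_gr G c) = carrier (H0 G)"
proof -
  let ?S = "skew_product G c"
  let ?Y = "unit_space ?S"
  note Y = unit_space_skew_product[of G c] and A = gtop_skew_product[of G c]
  interpret G: etale_graph G
    using assms(1) ample_groupoid.axioms(1) etale_groupoid_imp_etale_graph by blast
  interpret S: etale_graph ?S
    using G.etale_graph_axioms graded_groupoid.continuous_degree[OF assms(2)]
    by (rule etale_graph_skew_product)
  have shift_units: "local_homeomorphism ?Y ?Y shift"
    and shift_arrows: "local_homeomorphism (gtop ?S) (gtop ?S) shift"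
    and fst_units: "local_homeomorphism ?Y (unit_space G) fst"
    and fst_arrows: "local_homeomorphism (gtop ?S) (gtop G) fst"
    unfolding Y A by (rule local_homeomorphism_shift local_homeomorphism_fst)+
  have Lambda_Cc: "Lambda f \<in> carrier (Cc T)"
    if f: "f \<in> carrier (Cc T)" and T: "Hausdorff_space T" "local_homeomorphism T T shift"
    for f and T :: "('a \<times> int) topology"
    unfolding Lambda_eq_pushforward by (rule Cc_diff[OF pushforward_Cc[OF T(1) T(1) T(2) f] f])
  have Sigma_Cc: "Sigma_sum f \<in> carrier (Cc (unit_space G))" if "f \<in> carrier (Cc ?Y)" for f
    unfolding Sigma_sum_eq_pushforward
    by (rule pushforward_Cc[OF S.Hausdorff_units G.Hausdorff_units fst_units that])
  have Sigma_boundary: "Sigma_sum (boundary ?S f) = boundary G (Sigma_sum f)"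
    if "f \<in> carrier (Cc (gtop ?S))" for f
    unfolding Sigma_sum_eq_pushforward
    by (rule pushforward_boundary[OF S.etale_graph_axioms G.etale_graph_axioms fst_arrows fst_units _ _ that])
      auto

  interpret Lambda: H0_morphism ?S ?S Lambda
  proof
    fix f g assume f: "f \<in> carrier (Cc ?Y)" and g: "g \<in> carrier (Cc ?Y)"
    show "Lambda f \<in> carrier (Cc ?Y)" by (rule Lambda_Cc[OF f S.Hausdorff_units shift_units])
    show "Lambda (\<lambda>x. f x + g x) = (\<lambda>x. Lambda f x + Lambda g x)"
      by (auto simp: Lambda_def component_def)
  next
    fix f assume f: "f \<in> carrier (Cc (gtop ?S))"
    have sf: "pushforward shift f \<in> carrier (Cc (gtop ?S))"
      by (rule pushforward_Cc[OF S.Hausdorff_arrows S.Hausdorff_arrows shift_arrows f])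
    have "pushforward shift (boundary ?S f) = boundary ?S (pushforward shift f)"
      by (rule pushforward_boundary[OF S.etale_graph_axioms S.etale_graph_axioms shift_arrows
            shift_units _ _ f]) auto
    then have "Lambda (boundary ?S f) = boundary ?S (Lambda f)"
      unfolding Lambda_eq_pushforward S.boundary_diff[OF sf f] by simp
    then show "Lambda (boundary ?S f) \<in> boundaries ?S"
      using Lambda_Cc[OF f S.Hausdorff_arrows shift_arrows] by (auto simp: boundaries_def)
  qed

  interpret Sigma: H0_morphism ?S G Sigma_sum
  proof
    fix f g assume f: "f \<in> carrier (Cc ?Y)" and g: "g \<in> carrier (Cc ?Y)"
    show "Sigma_sum f \<in> carrier (Cc (unit_space G))" using f by (rule Sigma_Cc)
    show "Sigma_sum (\<lambda>x. f x + g x) = (\<lambda>x. Sigma_sum f x + Sigma_sum g x)"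
      unfolding Sigma_sum_eq_pushforward by (rule pushforward_add[OF fst_units f g])
  next
    fix f assume f: "f \<in> carrier (Cc (gtop ?S))"
    have "Sigma_sum f \<in> carrier (Cc (gtop G))"
      unfolding Sigma_sum_eq_pushforward
      by (rule pushforward_Cc[OF S.Hausdorff_arrows G.Hausdorff_arrows fst_arrows f])
    then show "Sigma_sum (boundary ?S f) \<in> boundaries G"
      using Sigma_boundary[OF f] by (simp add: boundaries_def)
  qed

  have Lambda_class: "Lambda_tilde G c (homology_class ?S f) = homology_class ?S (Lambda f)"
    and Sigma_class: "Sigma_tilde G (homology_class ?S f) = homology_class G (Sigma_sum f)"
    if "f \<in> carrier (Cc ?Y)" for f
    unfolding Lambda_tilde_def Sigma_tilde_def
    by (rule Lambda.induced_map_class[OF that] Sigma.induced_map_class[OF that])+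

  have "Lambda_tilde G c ` carrier (H0 ?S) = kernel (H0 ?S) (H0 G) (Sigma_tilde G)"
  proof (intro subset_antisym subsetI)
    fix X assume "X \<in> Lambda_tilde G c ` carrier (H0 ?S)"
    then obtain f where f: "f \<in> carrier (Cc ?Y)" and X: "X = homology_class ?S (Lambda f)"
      unfolding S.carrier_H0 using Lambda_class by auto
    have "Sigma_sum (Lambda f) = (\<lambda>x. 0)"
      using f unfolding Y by (rule Sigma_sum_Lambda[OF _ G.Hausdorff_units])
    then have "Sigma_tilde G X = \<one>\<^bsub>H0 G\<^esub>"
      unfolding X Sigma_class[OF Lambda.map_Cc[OF f]] G.one_H0 by simp
    then show "X \<in> kernel (H0 ?S) (H0 G) (Sigma_tilde G)"
      unfolding kernel_def S.carrier_H0 X using Lambda.map_Cc[OF f] by blast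
  next
    fix X assume "X \<in> kernel (H0 ?S) (H0 G) (Sigma_tilde G)"
    then obtain f where f: "f \<in> carrier (Cc ?Y)" and X: "X = homology_class ?S f"
        and "Sigma_tilde G (homology_class ?S f) = \<one>\<^bsub>H0 G\<^esub>"
      unfolding kernel_def S.carrier_H0 by blast
    then have "Sigma_sum f \<in> boundaries G"
      using G.homology_class_eq_one_iff[OF Sigma_Cc[OF f]] Sigma_class[OF f] by simp
    then obtain h where h: "h \<in> carrier (Cc (gtop G))" and \<Sigma>f: "Sigma_sum f = boundary G h"
      unfolding boundaries_def by blast
    \<comment> \<open>Any slice would do: the projection of \<open>k\<close> to the arrows of \<open>G\<close> is \<open>h\<close>.\<close>
    define k where "k = pushforward (\<lambda>g. (g, 0 :: int)) h"
    have k: "k \<in> carrier (Cc (gtop ?S))"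
      unfolding k_def using G.Hausdorff_arrows S.Hausdorff_arrows local_homeomorphism_slice h
      unfolding A by (rule pushforward_Cc)
    have "Sigma_sum (boundary ?S k) = boundary G h"
      using Sigma_boundary[OF k] unfolding k_def Sigma_sum_slice[OF h] .
    then have "Sigma_sum (\<lambda>x. f x - boundary ?S k x) = (\<lambda>x. 0)"
      unfolding Sigma_sum_eq_pushforward pushforward_diff[OF fst_units f S.boundary_Cc[OF k]]
      using \<Sigma>f by (simp add: Sigma_sum_eq_pushforward)
    then obtain g where g: "g \<in> carrier (Cc ?Y)" and \<Lambda>g: "Lambda g = (\<lambda>x. f x - boundary ?S k x)"
      using Sigma_sum_zero_imp_Lambda Cc_diff[OF f S.boundary_Cc[OF k]] unfolding Y by metis
    have "X = homology_class ?S (Lambda g)"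
      unfolding X S.homology_class_eq_iff[OF f Lambda.map_Cc[OF g]]
      using k by (simp add: \<Lambda>g boundaries_def)
    then show "X \<in> Lambda_tilde G c ` carrier (H0 ?S)"
      unfolding S.carrier_H0 using Lambda_class[OF g] g by blast
  qed
  moreover have "Sigma_tilde G ` carrier (H0 ?S) = carrier (H0 G)"
  proof (intro subset_antisym subsetI)
    fix X assume "X \<in> Sigma_tilde G ` carrier (H0 ?S)"
    then show "X \<in> carrier (H0 G)"
      unfolding S.carrier_H0 G.carrier_H0 using Sigma_class Sigma_Cc by auto
  next
    fix X assume "X \<in> carrier (H0 G)"
    then obtain f where f: "f \<in> carrier (Cc (unit_space G))" and X: "X = homology_class G f"
      unfolding G.carrier_H0 by blast
    let ?f = "pushforward (\<lambda>x. (x, 0 :: int)) f"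
    have "?f \<in> carrier (Cc ?Y)"
      using G.Hausdorff_units S.Hausdorff_units local_homeomorphism_slice f
      unfolding Y by (rule pushforward_Cc)
    moreover from this have "X = Sigma_tilde G (homology_class ?S ?f)"
      using Sigma_class by (simp add: X Sigma_sum_slice[OF f])
    ultimately show "X \<in> Sigma_tilde G ` carrier (H0 ?S)"
      unfolding S.carrier_H0 by blast
  qed
  moreover have "group_hom (H0 ?S) (H0 ?S) (Lambda_tilde G c)" "group_hom (H0 ?S) (H0 G) (Sigma_tilde G)"
    unfolding Lambda_tilde_def Sigma_tilde_def
    by (rule Lambda.group_hom_induced_map Sigma.group_hom_induced_map)+
  ultimately show ?thesis
    unfolding H0_gr_def
    by (intro conjI ballI S.comm_group_H0 G.comm_group_H0 Lambda.map_Cc Sigma_Cc Lambda_class Sigma_class)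
qed

end
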